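(* Let $A \in \mathbb{C}^{m \times n}$, $W \in \mathbb{C}^{n \times m}$ and $k= \mathrm{ind}(A,W)$. If $r(WAW)\neq r(A)$, then $A\{1',2',3',{1^{k}}'\}$ and $A\{1',2',4',{{}^{k}1}'\}$ are empty. If $r(WAW)=r(A)$, let $A^{\ominus,W}$ be an element of $A\{1',2',3',{1^{k}}'\}$ and $A_{\ominus,W}$ an element of $A\{1',2',4',{{}^{k}1}'\}$; then $$A\{1',2',3',{1^{k}}'\}=\{A^{\ominus, W}+(I_m-(WAW)^{\dagger}WAW)\,U\,((WAW)^{\dagger} -(WAW)^{\dagger}WAWA^{D,W}WAW(WAW)^{\dagger}) \mid U \in \mathbb{C}^{m \times m} \}$$ and $$A\{1',2',4',{{}^{k}1}'\}= \{A_{\ominus,W}+((WAW)^{\dagger}-(WAW)^{\dagger}WAWA^{D,W}WAW (WAW)^{\dagger})\, V\,(I_n -WAW(WAW)^{\dagger}) \mid V \in \mathbb{C}^{n \times n}\}.$$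
   Context: $r(\cdot)$ denotes rank, $*$ conjugate transpose, $M^\dagger$ the Moore-Penrose inverse. The index $\mathrm{ind}(M)$ of a square matrix $M$ is the smallest non-negative integer $j$ with $r(M^j)=r(M^{j+1})$ (with $M^0=I$); $\mathrm{ind}(A,W)=\max\{\mathrm{ind}(AW),\mathrm{ind}(WA)\}$. For $A,X \in \mathbb{C}^{m \times n}$, $W \in \mathbb{C}^{n \times m}$ and $k\ge \mathrm{ind}(A,W)$ consider the equations: $(1')$ $AWXWA=A$; $(2')$ $XWAWX=X$; $(3')$ $(WAWX)^*=WAWX$; $(4')$ $(XWAW)^*=XWAW$; $({1^k}')$ $XW(AW)^{k+1}=(AW)^k$; $({{}^k1}')$ $(AW)^{k+2}X=(AW)^kA$. $A\{1',2',3',{1^k}'\}$ and $A\{1',2',4',{{}^k1}'\}$ denote the sets of all $X\in\mathbb{C}^{m\times n}$ satisfying the listed equations. The $W$-weighted Drazin inverse $A^{D,W}\in\mathbb{C}^{m\times n}$ is the unique $X$ satisfying $XW(AW)^{k+1}=(AW)^k$, $XWAWX=X$, $AWX=XWA$ with $k=\mathrm{ind}(A,W)$. *)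

theory Defs
  imports "HOL-Analysis.Analysis"
begin

text \<open>An \<open>m \<times> n\<close> complex matrix has type \<^typ>\<open>complex^'n^'m\<close>: the row index comes last.\<close>

definition conj_transpose :: "complex^'n^'m \<Rightarrow> complex^'m^'n"
  where "conj_transpose M = map_matrix cnj (transpose M)"

text \<open>The operations \<open>*\<close> and \<open>^\<close> on type \<open>vec\<close> act componentwise, so powers with respect to the
  matrix product \<open>**\<close> need their own definition.\<close>

primrec matpow :: "complex^'m^'m \<Rightarrow> nat \<Rightarrow> complex^'m^'m"
  where
    "matpow M 0 = mat 1"
  | "matpow M (Suc j) = M ** matpow M j"

definition is_moore_penrose :: "complex^'n^'m \<Rightarrow> complex^'m^'n \<Rightarrow> bool"
  where "is_moore_penrose M X \<longleftrightarrow>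
    M ** X ** M = M \<and>
    X ** M ** X = X \<and>
    conj_transpose (M ** X) = M ** X \<and>
    conj_transpose (X ** M) = X ** M"

definition moore_penrose :: "complex^'n^'m \<Rightarrow> complex^'m^'n"
  where "moore_penrose M = (THE X. is_moore_penrose M X)"

definition mat_index :: "complex^'m^'m \<Rightarrow> nat"
  where "mat_index M = (LEAST j. rank (matpow M j) = rank (matpow M (j + 1)))"

definition weighted_index :: "complex^'n^'m \<Rightarrow> complex^'m^'n \<Rightarrow> nat"
  where "weighted_index A W = max (mat_index (A ** W)) (mat_index (W ** A))"

definition is_weighted_drazin ::
    "complex^'n^'m \<Rightarrow> complex^'m^'n \<Rightarrow> complex^'n^'m \<Rightarrow> bool"
  where "is_weighted_drazin A W X \<longleftrightarrow>
    X ** W ** matpow (A ** W) (weighted_index A W + 1) = matpow (A ** W) (weighted_index A W) \<and>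
    X ** W ** A ** W ** X = X \<and>
    A ** W ** X = X ** W ** A"

definition weighted_drazin :: "complex^'n^'m \<Rightarrow> complex^'m^'n \<Rightarrow> complex^'n^'m"
  where "weighted_drazin A W = (THE X. is_weighted_drazin A W X)"

definition eq1 :: "complex^'n^'m \<Rightarrow> complex^'m^'n \<Rightarrow> complex^'n^'m \<Rightarrow> bool"
  where "eq1 A W X \<longleftrightarrow> A ** W ** X ** W ** A = A"

definition eq2 :: "complex^'n^'m \<Rightarrow> complex^'m^'n \<Rightarrow> complex^'n^'m \<Rightarrow> bool"
  where "eq2 A W X \<longleftrightarrow> X ** W ** A ** W ** X = X"

definition eq3 :: "complex^'n^'m \<Rightarrow> complex^'m^'n \<Rightarrow> complex^'n^'m \<Rightarrow> bool"
  where "eq3 A W X \<longleftrightarrow> conj_transpose (W ** A ** W ** X) = W ** A ** W ** X"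

definition eq4 :: "complex^'n^'m \<Rightarrow> complex^'m^'n \<Rightarrow> complex^'n^'m \<Rightarrow> bool"
  where "eq4 A W X \<longleftrightarrow> conj_transpose (X ** W ** A ** W) = X ** W ** A ** W"

text \<open>The equations \<open>(1\<^sup>k')\<close> and \<open>(\<^sup>k1')\<close>, respectively.\<close>

definition eq1k :: "nat \<Rightarrow> complex^'n^'m \<Rightarrow> complex^'m^'n \<Rightarrow> complex^'n^'m \<Rightarrow> bool"
  where "eq1k k A W X \<longleftrightarrow> X ** W ** matpow (A ** W) (k + 1) = matpow (A ** W) k"

definition eqk1 :: "nat \<Rightarrow> complex^'n^'m \<Rightarrow> complex^'m^'n \<Rightarrow> complex^'n^'m \<Rightarrow> bool"
  where "eqk1 k A W X \<longleftrightarrow> matpow (A ** W) (k + 2) ** X = matpow (A ** W) k ** A"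

text \<open>\<open>A{1',2',3',1\<^sup>k'}\<close> and \<open>A{1',2',4',\<^sup>k1'}\<close>, respectively.\<close>

definition inverses_123_1k ::
    "nat \<Rightarrow> complex^'n^'m \<Rightarrow> complex^'m^'n \<Rightarrow> (complex^'n^'m) set"
  where "inverses_123_1k k A W = {X. eq1 A W X \<and> eq2 A W X \<and> eq3 A W X \<and> eq1k k A W X}"

definition inverses_124_k1 ::
    "nat \<Rightarrow> complex^'n^'m \<Rightarrow> complex^'m^'n \<Rightarrow> (complex^'n^'m) set"
  where "inverses_124_k1 k A W = {X. eq1 A W X \<and> eq2 A W X \<and> eq4 A W X \<and> eqk1 k A W X}"

end

theory Submission
  imports Defs
begin

text \<open>Put \<open>M = WAW\<close> and \<open>D = A\<^sup>D\<^sup>,\<^sup>W\<close>. Equation \<open>(1')\<close> factors \<open>A\<close> through \<open>M\<close>, so it forces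
  \<open>r(M) = r(A)\<close>; conversely \<open>r(M) = r(A)\<close> gives \<open>A = P W A = A W Q\<close>, which makes \<open>(1')\<close> equivalent
  to \<open>M X M = M\<close>. Since \<open>D\<close> has the column space of \<open>(AW)\<^sup>k\<close> and the row space of \<open>(AW)\<^sup>k A\<close>, the
  equations \<open>(1\<^sup>k')\<close> and \<open>(\<^sup>k1')\<close> become \<open>X M D = D\<close> and \<open>D M X = D\<close>. What remains uses only
  \<open>D M D = D\<close>: \<open>M\<^sup>\<dagger> + (1 - M\<^sup>\<dagger> M) D M M\<^sup>\<dagger>\<close> is a solution of the first system, all solutions have the
  same \<open>M X = M M\<^sup>\<dagger>\<close>, and conjugate transposition turns the second system into the first.\<close>

section \<open>Matrix algebra and conjugate transposes\<close>

lemma matrix_diff_ldistrib: "P ** (Q - R) = P ** Q - P ** (R :: 'a::ring_1^'p^'n)"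
  by (simp add: matrix_matrix_mult_def vec_eq_iff right_diff_distrib sum_subtractf)

lemma matrix_diff_rdistrib: "(P - Q) ** R = P ** R - Q ** (R :: 'a::ring_1^'p^'n)"
  by (simp add: matrix_matrix_mult_def vec_eq_iff left_diff_distrib sum_subtractf)

lemma matrix_add_rdistrib: "(P + Q) ** R = P ** R + Q ** (R :: 'a::semiring_1^'p^'n)"
  by (simp add: matrix_matrix_mult_def vec_eq_iff distrib_right sum.distrib)

lemma conj_transpose_mult: "conj_transpose (P ** Q) = conj_transpose Q ** conj_transpose P"
  by (simp add: conj_transpose_def map_matrix_def transpose_def matrix_matrix_mult_def
      vec_eq_iff mult.commute)

lemma conj_transpose_conj_transpose [simp]: "conj_transpose (conj_transpose P) = P"
  by (simp add: conj_transpose_def map_matrix_def transpose_def vec_eq_iff)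

lemma conj_transpose_eq_iff: "conj_transpose P = conj_transpose Q \<longleftrightarrow> P = Q"
  by (metis conj_transpose_conj_transpose)

lemma conj_transpose_add: "conj_transpose (P + Q) = conj_transpose P + conj_transpose Q"
  by (simp add: conj_transpose_def map_matrix_def transpose_def vec_eq_iff)

lemma conj_transpose_diff: "conj_transpose (P - Q) = conj_transpose P - conj_transpose Q"
  by (simp add: conj_transpose_def map_matrix_def transpose_def vec_eq_iff)

lemma conj_transpose_mat_1: "conj_transpose (mat 1) = mat 1"
  by (simp add: conj_transpose_def map_matrix_def transpose_def vec_eq_iff mat_def)

text \<open>The \<open>j\<close>-th diagonal entry of the product is the sum of the squared moduli
  of the entries in column \<open>j\<close> of \<open>P\<close>.\<close>

lemma conj_transpose_mult_self_eq_0: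
  assumes "conj_transpose P ** P = 0"
  shows "P = 0"
proof -
  have "P $ k $ j = 0" for j k
  proof -
    have "complex_of_real (\<Sum>i\<in>UNIV. (cmod (P $ i $ j))\<^sup>2) = (conj_transpose P ** P) $ j $ j"
      by (simp add: conj_transpose_def map_matrix_def transpose_def matrix_matrix_mult_def
          complex_norm_square mult.commute del: of_real_power)
    also have "\<dots> = 0" using assms by simp
    finally have "(\<Sum>i\<in>UNIV. (cmod (P $ i $ j))\<^sup>2) = 0"
      unfolding of_real_eq_0_iff .
    then show ?thesis by (simp add: sum_nonneg_eq_0_iff)
  qed
  then show ?thesis by (simp add: vec_eq_iff)
qed

lemma conj_transpose_mult_self_cancel:
  assumes "conj_transpose M ** M ** P = conj_transpose M ** M ** Q"
  shows "M ** P = M ** Q"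
proof -
  have "conj_transpose M ** (M ** (P - Q)) = 0"
    using assms by (simp add: matrix_mul_assoc matrix_diff_ldistrib)
  then have "conj_transpose (M ** (P - Q)) ** (M ** (P - Q)) = 0"
    by (simp add: conj_transpose_mult flip: matrix_mul_assoc)
  from conj_transpose_mult_self_eq_0[OF this] show ?thesis
    by (simp add: matrix_diff_ldistrib)
qed

section \<open>Generalized inverses and rank\<close>

text \<open>\<open>G\<close> is the matrix of a linear map that sends each vector in the range of
  \<open>B\<close> to one of its preimages.\<close>

lemma inner_inverse_exists:
  fixes B :: "'a::field^'n^'m"
  shows "\<exists>G. B ** G ** B = B"
proof -
  obtain g where g: "Vector_Spaces.linear (*s) (*s) g" "\<forall>v\<in>range ((*v) B). B *v g v = v"
    using vec.linear_exists_right_inverse_on[OF matrix_vector_mul_linear_gen[of B] vec.subspace_UNIV]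
    by auto
  have "(B ** matrix g ** B) *v x = B *v x" for x
    using g by (simp add: matrix_works flip: matrix_vector_mul_assoc)
  then show ?thesis by (metis matrix_eq)
qed

text \<open>Row \<open>i\<close> of \<open>Q\<close> is the image of the \<open>i\<close>-th unit
  vector under the transpose. As \<open>rank\<close> is the dimension of the row span, this reduces
  rank questions about products to ranges of composed maps.\<close>

lemma span_rows_eq_range:
  fixes Q :: "'a::field^'n^'m"
  shows "vec.span (rows Q) = range ((*v) (transpose Q))"
proof
  have "row i Q = transpose Q *v axis i 1" for i
    by (simp add: matrix_vector_mult_def axis_def row_def transpose_def vec_eq_iff if_distrib
        cong: if_cong del: transpose_matrix_vector)
  then have "rows Q \<subseteq> range ((*v) (transpose Q))"
    unfolding rows_def by auto
  moreover have "vec.subspace (range ((*v) (transpose Q)))"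
    by (rule vec.subspace_image[OF vec.subspace_UNIV])
  ultimately show "vec.span (rows Q) \<subseteq> range ((*v) (transpose Q))"
    by (rule vec.span_minimal)
  show "range ((*v) (transpose Q)) \<subseteq> vec.span (rows Q)"
    using matrix_vector_mult_in_columnspace_gen[of "transpose Q"] columns_transpose[of Q] by auto
qed

text \<open>The library proves the next two bounds over the reals only.\<close>

lemma rank_mult_le_left:
  fixes P :: "'a::field^'n^'m" and Q :: "'a^'p^'n"
  shows "rank (P ** Q) \<le> rank P"
proof -
  have "rows (P ** Q) = (*v) (transpose Q) ` rows P"
    by (auto simp: rows_def row_def matrix_matrix_mult_def matrix_vector_mult_def transpose_def
        vec_eq_iff mult.commute image_iff)
  then show ?thesis
    unfolding row_rank_def_gen
    using vec.dim_image_le[OF matrix_vector_mul_linear_gen, of "transpose Q" "rows P"] by simp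
qed

lemma span_rows_mult_subset:
  fixes P :: "'a::field^'n^'m" and Q :: "'a^'p^'n"
  shows "vec.span (rows (P ** Q)) \<subseteq> vec.span (rows Q)"
  unfolding span_rows_eq_range
  by (auto simp: matrix_transpose_mul simp flip: matrix_vector_mul_assoc
      simp del: transpose_matrix_vector)

lemma rank_mult_le_right:
  fixes P :: "'a::field^'n^'m" and Q :: "'a^'p^'n"
  shows "rank (P ** Q) \<le> rank Q"
  unfolding row_rank_def_gen
  using vec.dim_subset[OF span_rows_mult_subset] by (simp only: vec.dim_span)

text \<open>Equal dimensions turn the inclusion of row spaces into an equality, so each row of
  \<open>Q\<close> is a combination of rows of \<open>P ** Q\<close>. The coefficient vectors form
  the rows of \<open>Z\<close>.\<close>

lemma rank_mult_eq_right_imp_factor: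
  fixes P :: "'a::field^'n^'m" and Q :: "'a^'p^'n"
  assumes "rank (P ** Q) = rank Q"
  obtains Z where "Q = Z ** P ** Q"
proof -
  have "vec.span (rows (P ** Q)) = vec.span (rows Q)"
    using assms unfolding row_rank_def_gen
    by (intro vec.subspace_dim_equal[OF vec.subspace_span vec.subspace_span span_rows_mult_subset])
      (simp only: vec.dim_span)
  then have "row i Q \<in> range ((*v) (transpose (P ** Q)))" for i
    unfolding span_rows_eq_range[symmetric] by (auto simp: rows_def intro: vec.span_base)
  then have "\<forall>i. \<exists>z. row i Q = transpose (P ** Q) *v z" by blast
  then obtain z where z: "\<And>i. row i Q = transpose (P ** Q) *v z i" by metis
  have "Q $ i $ j = ((\<chi> i. z i) ** (P ** Q)) $ i $ j" for i j
  proof -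
    have "Q $ i $ j = row i Q $ j" by (simp add: row_def)
    also have "\<dots> = (\<Sum>l\<in>UNIV. (P ** Q) $ l $ j * z i $ l)"
      by (simp only: z matrix_vector_mult_def transpose_def vec_lambda_beta)
    also have "\<dots> = ((\<chi> i. z i) ** (P ** Q)) $ i $ j"
      by (simp only: matrix_matrix_mult_def[of "\<chi> i. z i"] vec_lambda_beta mult.commute)
    finally show ?thesis .
  qed
  then have "Q = (\<chi> i. z i) ** (P ** Q)" by (simp only: vec_eq_iff) blast
  then show thesis using that by (simp add: matrix_mul_assoc)
qed

text \<open>\<open>H\<close> is an inner inverse of the Gram matrix \<open>?B\<close>; the leading
  adjoint of \<open>M\<close> is then cancelled from \<open>?B ** H ** ?B = ?B\<close>.\<close>

lemma conj_transpose_mult_self_factor: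
  fixes M :: "complex^'n^'m"
  obtains H where "M ** H ** conj_transpose M ** M = M"
proof -
  let ?B = "conj_transpose M ** M"
  obtain H where "?B ** H ** ?B = ?B"
    using inner_inverse_exists by blast
  then have "?B ** (H ** ?B) = ?B ** mat 1"
    by (simp add: matrix_mul_assoc)
  from conj_transpose_mult_self_cancel[OF this] show thesis
    using that by (simp add: matrix_mul_assoc)
qed

lemma rank_conj_transpose: "rank (conj_transpose M) = rank M"
proof -
  have "rank M \<le> rank (conj_transpose M)" for M :: "complex^'x^'y"
  proof -
    obtain H where "M ** H ** conj_transpose M ** M = M"
      by (rule conj_transpose_mult_self_factor)
    then have "rank M \<le> rank (conj_transpose M ** M)"
      by (metis matrix_mul_assoc rank_mult_le_right)
    also have "\<dots> \<le> rank (conj_transpose M)" by (rule rank_mult_le_left)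
    finally show ?thesis .
  qed
  from this[of M] this[of "conj_transpose M"] show ?thesis by simp
qed

lemma rank_mult_eq_left_imp_factor:
  fixes P :: "complex^'n^'m" and Q :: "complex^'p^'n"
  assumes "rank (P ** Q) = rank P"
  obtains Z where "P = P ** Q ** Z"
proof -
  have "rank (conj_transpose Q ** conj_transpose P) = rank (conj_transpose P)"
    using assms by (simp add: rank_conj_transpose flip: conj_transpose_mult)
  then obtain Z where "conj_transpose P = Z ** conj_transpose Q ** conj_transpose P"
    by (rule rank_mult_eq_right_imp_factor)
  then have "P = P ** Q ** conj_transpose Z"
    by (metis conj_transpose_conj_transpose conj_transpose_mult matrix_mul_assoc)
  then show thesis by (rule that)
qed

section \<open>The Moore--Penrose inverse\<close>

text \<open>\<open>X = H M\<^sup>*\<close>, with \<open>H\<close> an inner inverse of \<open>M\<^sup>*M\<close>.\<close>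

lemma inverse_13_exists:
  fixes M :: "complex^'n^'m"
  obtains X where "M ** X ** M = M" "conj_transpose (M ** X) = M ** X"
proof -
  obtain H where H: "M ** H ** conj_transpose M ** M = M"
    by (rule conj_transpose_mult_self_factor)
  let ?P = "M ** H ** conj_transpose M"
  \<comment> \<open>The adjoint of \<open>?P\<close> starts with the factor \<open>M\<close>, which
    \<open>?P\<close> fixes. The left side is Hermitian, hence so is \<open>?P\<close>.\<close>
  have "?P ** conj_transpose ?P = conj_transpose ?P"
    using H by (simp add: conj_transpose_mult matrix_mul_assoc)
  then have "conj_transpose ?P = ?P"
    by (metis conj_transpose_conj_transpose conj_transpose_mult)
  with H that[of "H ** conj_transpose M"] show thesis by (simp add: matrix_mul_assoc)
qed

text \<open>Both products are orthogonal projectors onto the column space of \<open>M\<close>.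
  Concretely, \<open>(M ** Y) ** (M ** X)\<close> equals \<open>M ** X\<close>, while its adjoint
  equals \<open>M ** Y\<close>.\<close>

lemma inverse_13_mult_unique:
  assumes "M ** X ** M = M" "conj_transpose (M ** X) = M ** X"
    and "M ** Y ** M = M" "conj_transpose (M ** Y) = M ** Y"
  shows "M ** X = M ** Y"
proof -
  have "M ** X = conj_transpose ((M ** Y) ** (M ** X))"
    using assms by (simp add: matrix_mul_assoc)
  also have "\<dots> = (M ** X) ** (M ** Y)"
    unfolding conj_transpose_mult[of "M ** Y"] using assms by simp
  finally show ?thesis using assms by (simp add: matrix_mul_assoc)
qed

lemma is_moore_penrose_conj_transpose:
  assumes "is_moore_penrose M X"
  shows "is_moore_penrose (conj_transpose M) (conj_transpose X)"
  using assms unfolding is_moore_penrose_def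
  by (metis conj_transpose_conj_transpose conj_transpose_mult matrix_mul_assoc)

text \<open>Applied to \<open>M\<close> and to its adjoint, \<open>inverse_13_mult_unique\<close>
  fixes \<open>M ** X\<close> and \<open>X ** M\<close>; then \<open>X = X ** M ** X\<close> is
  determined.\<close>

lemma is_moore_penrose_unique:
  assumes X: "is_moore_penrose M X" and Y: "is_moore_penrose M Y"
  shows "X = Y"
proof -
  have "M ** X = M ** Y"
    using X Y inverse_13_mult_unique unfolding is_moore_penrose_def by blast
  moreover have "conj_transpose M ** conj_transpose X = conj_transpose M ** conj_transpose Y"
    using X[THEN is_moore_penrose_conj_transpose] Y[THEN is_moore_penrose_conj_transpose]
      inverse_13_mult_unique
    unfolding is_moore_penrose_def by blast
  then have "X ** M = Y ** M" by (simp add: conj_transpose_eq_iff flip: conj_transpose_mult)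
  ultimately show ?thesis
    using X Y unfolding is_moore_penrose_def by (metis matrix_mul_assoc)
qed

lemma is_moore_penrose_moore_penrose: "is_moore_penrose M (moore_penrose M)"
proof -
  obtain X where X: "M ** X ** M = M" "conj_transpose (M ** X) = M ** X"
    by (rule inverse_13_exists)
  obtain Z where Z: "conj_transpose M ** Z ** conj_transpose M = conj_transpose M"
    "conj_transpose (conj_transpose M ** Z) = conj_transpose M ** Z"
    by (rule inverse_13_exists)
  \<comment> \<open>\<open>Y\<close> is an inner inverse with \<open>Y ** M\<close> Hermitian. The
    product \<open>Y ** M ** X\<close> inherits the symmetry on one side from \<open>X\<close> and
    on the other from \<open>Y\<close>.\<close>
  define Y where "Y = conj_transpose Z"
  have Y: "M ** Y ** M = M" "conj_transpose (Y ** M) = Y ** M"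
    using Z unfolding Y_def
    by (metis conj_transpose_conj_transpose conj_transpose_mult matrix_mul_assoc)+
  have "M ** (Y ** M ** X) = M ** X" "(Y ** M ** X) ** M = Y ** M"
    using X Y by (simp_all add: matrix_mul_assoc) (metis matrix_mul_assoc)
  then have "is_moore_penrose M (Y ** M ** X)"
    using X Y unfolding is_moore_penrose_def by (metis matrix_mul_assoc)
  then show ?thesis
    unfolding moore_penrose_def by (metis theI is_moore_penrose_unique)
qed

section \<open>The weighted Drazin inverse\<close>

lemma matpow_add: "matpow B (i + j) = matpow B i ** matpow B j"
  by (induction i) (simp_all add: matrix_mul_assoc)

lemma matpow_Suc_right: "matpow B (Suc j) = matpow B j ** B"
  using matpow_add[of B j 1] by simp

text \<open>The ranks of the powers cannot drop strictly forever, so the \<open>LEAST\<close> in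
  \<open>mat_index\<close> is attained.\<close>

lemma rank_matpow_mat_index:
  "rank (matpow B (mat_index B)) = rank (matpow B (mat_index B + 1))"
proof -
  have "\<exists>j. rank (matpow B j) = rank (matpow B (j + 1))"
  proof (rule ccontr)
    assume "\<not> ?thesis"
    then have "rank (matpow B (Suc j)) < rank (matpow B j)" for j
      using rank_mult_le_right[of B "matpow B j"]
      by (metis Suc_eq_plus1 matpow.simps(2) le_neq_implies_less)
    then have "rank (matpow B j) + j \<le> rank (matpow B 0)" for j
      by (induction j) (simp, metis add_Suc_right Suc_leI add_less_mono1 order_less_le_trans)
    from this[of "Suc (rank (matpow B 0))"] show False by simp
  qed
  then show ?thesis unfolding mat_index_def by (rule LeastI_ex)
qed

lemma matpow_left_absorb:
  assumes "Z ** matpow B (Suc j) = matpow B j"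
  shows "matpow Z i ** matpow B (j + i) = matpow B j"
proof (induction i)
  case (Suc i)
  have "matpow Z (Suc i) ** matpow B (j + Suc i) = matpow Z i ** (Z ** matpow B (Suc j)) ** matpow B i"
    by (simp only: matpow_Suc_right[of Z] add_Suc_right add_Suc[symmetric] matpow_add[of B "Suc j"]
        matrix_mul_assoc)
  also have "\<dots> = matpow Z i ** matpow B (j + i)"
    by (simp only: assms matpow_add matrix_mul_assoc)
  finally show ?case using Suc by simp
qed simp

lemma matpow_right_absorb:
  assumes "matpow B (Suc j) ** Z = matpow B j"
  shows "matpow B (i + j) ** matpow Z i = matpow B j"
proof (induction i)
  case (Suc i)
  have "matpow B (Suc i + j) ** matpow Z (Suc i) = matpow B i ** (matpow B (Suc j) ** Z) ** matpow Z i"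
    by (simp only: matpow.simps(2)[of Z] add_Suc add_Suc_right[symmetric] matpow_add[of B i]
        matrix_mul_assoc)
  also have "\<dots> = matpow B (i + j) ** matpow Z i"
    by (simp only: assms matpow_add matrix_mul_assoc)
  finally show ?case using Suc by simp
qed simp

text \<open>Rank stabilization makes \<open>B\<close> cancellable from either side of
  \<open>matpow B j\<close>, and repeated cancellation gives two formulas for \<open>E\<close>. The
  last clause covers every larger \<open>k\<close> because the weighted index is a maximum and may
  exceed \<open>mat_index (A ** W)\<close>.\<close>

lemma drazin_inverse_exists:
  fixes B :: "complex^'m^'m"
  obtains E where "E ** B ** E = E" "E ** B = B ** E"
    "\<And>k. mat_index B \<le> k \<Longrightarrow> E ** matpow B (Suc k) = matpow B k"
proof -
  define j where "j = mat_index B"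
  have r: "rank (matpow B (Suc j)) = rank (matpow B j)"
    using rank_matpow_mat_index[of B] by (simp add: j_def)
  obtain Z where "matpow B j = Z ** B ** matpow B j"
    using r by (auto elim: rank_mult_eq_right_imp_factor)
  then have Z: "Z ** matpow B (Suc j) = matpow B j"
    by (simp add: matrix_mul_assoc)
  obtain Y where "matpow B j = matpow B j ** B ** Y"
    using r unfolding matpow_Suc_right by (auto elim: rank_mult_eq_left_imp_factor)
  then have Y: "matpow B (Suc j) ** Y = matpow B j"
    by (simp only: matpow_Suc_right)
  \<comment> \<open>The exponent \<open>j + Suc j\<close> of \<open>?L\<close> leaves exactly
    \<open>matpow B j\<close> after \<open>Suc j\<close> cancellations on either side. Evaluating
    \<open>?P ** ?L ** ?Q\<close> in two ways identifies both formulas for \<open>E\<close>.\<close>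
  let ?P = "matpow Z (Suc j)" and ?Q = "matpow Y (Suc j)" and ?L = "matpow B (j + Suc j)"
  have PL: "?P ** ?L = matpow B j" and LQ: "?L ** ?Q = matpow B j"
    using matpow_left_absorb[OF Z, of "Suc j"] matpow_right_absorb[OF Y, of "Suc j"]
    by (simp_all only: add.commute)
  define E where "E = ?P ** matpow B j"
  have E': "E = matpow B j ** ?Q"
    unfolding E_def by (metis PL LQ matrix_mul_assoc)
  have EB: "E ** matpow B (Suc j) = matpow B j"
    unfolding E_def by (metis PL matpow_add matrix_mul_assoc)
  have "E ** B = ?P ** matpow B (Suc j)"
    unfolding E_def by (simp only: matpow_Suc_right matrix_mul_assoc)
  also have "\<dots> = ?P ** (B ** (?L ** ?Q))"
    unfolding LQ by simp
  also have "\<dots> = ?P ** ?L ** B ** ?Q"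
    by (metis matpow.simps(2) matpow_Suc_right matrix_mul_assoc)
  also have "\<dots> = B ** E"
    unfolding PL E' by (metis matpow.simps(2) matpow_Suc_right matrix_mul_assoc)
  finally have comm: "E ** B = B ** E" .
  have "E ** B ** E = E ** matpow B (Suc j) ** ?Q"
    by (simp add: E' matrix_mul_assoc)
  then have "E ** B ** E = E"
    unfolding EB by (simp only: flip: E')
  moreover have "E ** matpow B (Suc k) = matpow B k" if "j \<le> k" for k
  proof -
    from that obtain i where "k = j + i" by (metis le_add_diff_inverse)
    then show ?thesis
      by (metis EB add_Suc matpow_add matrix_mul_assoc)
  qed
  ultimately show thesis using comm that unfolding j_def by blast
qed

text \<open>The weighted Drazin inverse is \<open>((AW)\<^sup>D)\<^sup>2 A\<close>.\<close>

lemma is_weighted_drazin_exists: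
  fixes A :: "complex^'n^'m" and W :: "complex^'m^'n"
  shows "\<exists>D. is_weighted_drazin A W D"
proof -
  define B where "B = A ** W"
  obtain E where E: "E ** B ** E = E" "E ** B = B ** E"
    "\<And>k. mat_index B \<le> k \<Longrightarrow> E ** matpow B (Suc k) = matpow B k"
    by (rule drazin_inverse_exists[of B]) blast
  define k where "k = weighted_index A W"
  have k: "mat_index B \<le> k" by (simp add: B_def k_def weighted_index_def)
  \<comment> \<open>Thus the witness times \<open>W\<close> is \<open>E\<close>, which reduces the
    weighted equations to those of the ordinary Drazin inverse of \<open>B\<close>.\<close>
  have EEB: "E ** E ** B = E" using E by (metis matrix_mul_assoc)
  have "E ** E ** A ** W ** matpow B (k + 1) = E ** matpow B (k + 1)"
    using EEB by (simp add: B_def flip: matrix_mul_assoc)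
  moreover have "E ** E ** A ** W ** A ** W ** (E ** E ** A) = E ** E ** B ** (B ** E) ** E ** A"
    by (simp add: B_def matrix_mul_assoc)
  moreover have "\<dots> = E ** E ** A"
    unfolding EEB by (metis E(1,2) matrix_mul_assoc)
  moreover have "A ** W ** (E ** E ** A) = E ** E ** A ** W ** A"
    using E(2) unfolding B_def by (metis matrix_mul_assoc)
  ultimately have "is_weighted_drazin A W (E ** E ** A)"
    using E(3)[OF k] by (simp add: is_weighted_drazin_def B_def k_def)
  then show ?thesis ..
qed

text \<open>Commutation rewrites \<open>D = D ** W ** A ** W ** D\<close> as
  \<open>D = A ** W ** D ** W ** D\<close>; each substitution gains one factor \<open>A ** W\<close>
  on the left.\<close>

lemma weighted_drazin_left_factor:
  assumes "is_weighted_drazin A W D"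
  shows "\<exists>Y. D = matpow (A ** W) i ** Y"
proof (induction i)
  case (Suc i)
  then obtain Y where Y: "D = matpow (A ** W) i ** Y" ..
  have "D = A ** W ** D ** W ** D"
    using assms unfolding is_weighted_drazin_def by metis
  also have "\<dots> = A ** W ** (matpow (A ** W) i ** Y) ** W ** D"
    using Y by simp
  also have "\<dots> = matpow (A ** W) (Suc i) ** (Y ** W ** D)"
    by (simp add: matrix_mul_assoc)
  finally show ?case by (rule exI)
qed simp

lemma weighted_drazin_right_factor:
  assumes "is_weighted_drazin A W D"
  shows "\<exists>Z. D = Z ** matpow (A ** W) i ** A"
proof (induction i)
  have *: "D = D ** W ** D ** W ** A"
    using assms unfolding is_weighted_drazin_def by (metis matrix_mul_assoc)
  case 0
  show ?case using * by (auto intro!: exI[of _ "D ** W ** D ** W"])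
  case (Suc i)
  then obtain Z where "D = Z ** matpow (A ** W) i ** A" ..
  with * have "D = D ** W ** (Z ** matpow (A ** W) i ** A) ** W ** A"
    by metis
  also have "\<dots> = (D ** W ** Z) ** matpow (A ** W) (Suc i) ** A"
    by (simp only: matpow_Suc_right matrix_mul_assoc)
  finally show ?case by (rule exI)
qed

lemma weighted_drazin_mult_matpow:
  assumes "is_weighted_drazin A W D" "k = weighted_index A W"
  shows "D ** (W ** A ** W) ** matpow (A ** W) k = matpow (A ** W) k"
  using assms by (simp add: is_weighted_drazin_def matrix_mul_assoc)

text \<open>\<open>D ** W\<close> commutes with powers of \<open>A ** W\<close>, so the
  \<open>D\<close> on the right can be moved to the left, where the defining equation of
  \<open>D\<close> applies.\<close>

lemma matpow_mult_weighted_drazin: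
  assumes D: "is_weighted_drazin A W D" and k: "k = weighted_index A W"
  shows "matpow (A ** W) k ** A ** (W ** A ** W) ** D = matpow (A ** W) k ** A"
proof -
  have comm: "A ** W ** (D ** W) = D ** W ** (A ** W)"
    using D unfolding is_weighted_drazin_def by (metis matrix_mul_assoc)
  have pow: "matpow (A ** W) i ** (D ** W) = D ** W ** matpow (A ** W) i" for i
    by (induction i) (simp, metis comm matpow.simps(2) matrix_mul_assoc)
  have "matpow (A ** W) k ** A ** (W ** A ** W) ** D = matpow (A ** W) (Suc k) ** (A ** W ** D)"
    by (simp only: matpow_Suc_right matrix_mul_assoc)
  also have "\<dots> = matpow (A ** W) (Suc k) ** (D ** W) ** A"
    using D unfolding is_weighted_drazin_def by (simp only: matrix_mul_assoc)
  also have "\<dots> = matpow (A ** W) k ** A"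
    unfolding pow using D k by (simp add: is_weighted_drazin_def)
  finally show ?thesis .
qed

text \<open>\<open>D\<close> and \<open>matpow (A ** W) k\<close> are right multiples of each other,
  so left multiplication by \<open>X ** (W ** A ** W)\<close> fixes one exactly when it fixes the
  other.\<close>

lemma eq1k_iff_mult_weighted_drazin:
  assumes D: "is_weighted_drazin A W D" and k: "k = weighted_index A W"
  shows "eq1k k A W X \<longleftrightarrow> X ** (W ** A ** W) ** D = D"
proof -
  obtain Y where "D = matpow (A ** W) k ** Y"
    using weighted_drazin_left_factor[OF D] by blast
  moreover have "eq1k k A W X \<longleftrightarrow> X ** (W ** A ** W) ** matpow (A ** W) k = matpow (A ** W) k"
    by (simp add: eq1k_def matrix_mul_assoc)
  ultimately show ?thesis
    using weighted_drazin_mult_matpow[OF D k] by (metis matrix_mul_assoc)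
qed

text \<open>The row-space counterpart: \<open>D\<close> and \<open>matpow (A ** W) k ** A\<close>
  are left multiples of each other.\<close>

lemma eqk1_iff_mult_weighted_drazin:
  assumes D: "is_weighted_drazin A W D" and k: "k = weighted_index A W"
  shows "eqk1 k A W X \<longleftrightarrow> D ** (W ** A ** W) ** X = D"
proof -
  obtain Z where "D = Z ** matpow (A ** W) k ** A"
    using weighted_drazin_right_factor[OF D] by blast
  moreover have "eqk1 k A W X \<longleftrightarrow>
      matpow (A ** W) k ** A ** (W ** A ** W) ** X = matpow (A ** W) k ** A"
    by (simp only: eqk1_def add_2_eq_Suc' matpow_Suc_right matrix_mul_assoc)
  ultimately show ?thesis
    using matpow_mult_weighted_drazin[OF D k] by (metis matrix_mul_assoc)
qed

text \<open>Both matrices equal \<open>Y ** (W ** A ** W) ** X\<close>: \<open>Y\<close> satisfies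
  \<open>eq1k\<close>, which fixes \<open>X\<close>, and \<open>X\<close> satisfies
  \<open>eqk1\<close>, which fixes \<open>Y\<close>.\<close>

lemma is_weighted_drazin_unique:
  assumes X: "is_weighted_drazin A W X" and Y: "is_weighted_drazin A W Y"
  shows "X = Y"
proof -
  have "Y ** (W ** A ** W) ** X = X"
    using Y by (simp add: is_weighted_drazin_def eq1k_def flip: eq1k_iff_mult_weighted_drazin[OF X refl])
  moreover have "Y ** (W ** A ** W) ** X = Y"
    unfolding eqk1_iff_mult_weighted_drazin[OF Y refl, symmetric]
    by (simp add: eqk1_iff_mult_weighted_drazin[OF X refl])
      (use X in \<open>simp add: is_weighted_drazin_def matrix_mul_assoc\<close>)
  ultimately show ?thesis by simp
qed

lemma is_weighted_drazin_weighted_drazin: "is_weighted_drazin A W (weighted_drazin A W)"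
  unfolding weighted_drazin_def
  using is_weighted_drazin_exists is_weighted_drazin_unique by (metis theI)

section \<open>Reflexive inverses fixing an outer inverse\<close>

text \<open>The solution sets with \<open>A\<close> and \<open>k\<close> abstracted away:
  \<open>M\<close> stands for \<open>W ** A ** W\<close> and \<open>D\<close> for the weighted
  Drazin inverse.\<close>

definition inverses_123_fixing :: "complex^'n^'m \<Rightarrow> complex^'m^'n \<Rightarrow> (complex^'m^'n) set"
  where "inverses_123_fixing M D =
    {X. M ** X ** M = M \<and> X ** M ** X = X \<and> conj_transpose (M ** X) = M ** X \<and> X ** M ** D = D}"

definition inverses_124_fixing :: "complex^'n^'m \<Rightarrow> complex^'m^'n \<Rightarrow> (complex^'m^'n) set"
  where "inverses_124_fixing M D =
    {X. M ** X ** M = M \<and> X ** M ** X = X \<and> conj_transpose (X ** M) = X ** M \<and> D ** M ** X = D}"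

text \<open>Adjoints reverse products, which exchanges the two Hermitian conditions and the sides on
  which \<open>D\<close> is fixed.\<close>

lemma mem_inverses_124_fixing_iff:
  "X \<in> inverses_124_fixing M D \<longleftrightarrow>
    conj_transpose X \<in> inverses_123_fixing (conj_transpose M) (conj_transpose D)"
  unfolding inverses_123_fixing_def inverses_124_fixing_def mem_Collect_eq
  by (simp add: conj_transpose_eq_iff matrix_mul_assoc flip: conj_transpose_mult)
    (auto simp: matrix_mul_assoc)

lemma inverses_123_fixing_nonempty:
  assumes D: "D ** M ** D = D"
  shows "inverses_123_fixing M D \<noteq> {}"
proof -
  define G where "G = moore_penrose M"
  have G: "M ** G ** M = M" "G ** M ** G = G" "conj_transpose (M ** G) = M ** G"
    using is_moore_penrose_moore_penrose[of M] by (simp_all add: is_moore_penrose_def G_def)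
  \<comment> \<open>The correction to \<open>G\<close> is annihilated by \<open>M\<close> on the
    left, so \<open>M ** X = M ** G\<close>; applied to \<open>M ** D\<close> it supplies
    \<open>(mat 1 - G ** M) ** D\<close>, the part of \<open>D\<close> that \<open>G ** M\<close>
    misses.\<close>
  define X where "X = G + (mat 1 - G ** M) ** D ** M ** G"
  have "M ** (mat 1 - G ** M) = 0"
    using G(1) by (simp add: matrix_diff_ldistrib matrix_mul_assoc)
  then have MX: "M ** X = M ** G"
    by (simp add: X_def matrix_add_ldistrib matrix_mul_assoc)
  have XMG: "X ** M ** G = X"
    using G(2) unfolding X_def matrix_add_rdistrib by (metis matrix_mul_assoc)
  have "X ** M ** D = D"
  proof -
    have "(mat 1 - G ** M) ** D ** M ** G ** M ** D = (mat 1 - G ** M) ** (D ** M ** D)"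
      using G(1) by (metis matrix_mul_assoc)
    then show ?thesis
      by (simp add: X_def matrix_add_rdistrib D) (simp add: matrix_diff_rdistrib)
  qed
  moreover have "X ** M ** X = X"
    using MX XMG by (metis matrix_mul_assoc)
  ultimately have "X \<in> inverses_123_fixing M D"
    using G MX by (simp add: inverses_123_fixing_def)
  then show ?thesis by blast
qed

text \<open>The difference \<open>E\<close> of two members satisfies
  \<open>M E = 0\<close>, \<open>E M D = 0\<close> and \<open>E M M\<^sup>\<dagger> = E\<close>; then \<open>U = E M\<close> represents it.\<close>

lemma inverses_123_fixing_eq:
  assumes D: "D ** M ** D = D" and X0: "X0 \<in> inverses_123_fixing M D"
    and mp: "is_moore_penrose M G"
  shows "inverses_123_fixing M D =
    {X0 + (mat 1 - G ** M) ** U ** (G - G ** M ** D ** M ** G) | U. True}" (is "_ = ?R")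
proof
  have G: "M ** G ** M = M" "G ** M ** G = G" "conj_transpose (M ** G) = M ** G"
    using mp by (simp_all add: is_moore_penrose_def)
  let ?C = "G - G ** M ** D ** M ** G"
  have MX: "M ** X = M ** G" if "X \<in> inverses_123_fixing M D" for X
    using that G inverse_13_mult_unique by (auto simp: inverses_123_fixing_def)
  have XMG: "X ** M ** G = X" if "X \<in> inverses_123_fixing M D" for X
    using that MX[OF that] by (simp add: inverses_123_fixing_def) (metis matrix_mul_assoc)
  show "inverses_123_fixing M D \<subseteq> ?R"
  proof
    fix X assume X: "X \<in> inverses_123_fixing M D"
    define E where "E = X - X0"
    have ME: "M ** E = 0"
      using MX[OF X] MX[OF X0] by (simp add: E_def matrix_diff_ldistrib)
    have EMD: "E ** M ** D = 0"
      using X X0 by (simp add: E_def matrix_diff_rdistrib inverses_123_fixing_def)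
    have EMG: "E ** M ** G = E"
      using XMG[OF X] XMG[OF X0] by (simp add: E_def matrix_diff_rdistrib)
    have "(mat 1 - G ** M) ** (E ** M) ** ?C = E ** M ** ?C"
      using ME by (simp add: matrix_diff_rdistrib matrix_mul_assoc)
        (metis ME matrix_mul_assoc times0_left times0_right diff_zero)
    also have "\<dots> = E"
      using EMD EMG by (simp add: matrix_diff_ldistrib matrix_mul_assoc)
    finally have "X = X0 + (mat 1 - G ** M) ** (E ** M) ** ?C"
      by (simp add: E_def)
    then show "X \<in> ?R" by blast
  qed
  show "?R \<subseteq> inverses_123_fixing M D"
  proof
    fix X assume "X \<in> ?R"
    then obtain U where X: "X = X0 + (mat 1 - G ** M) ** U ** ?C" by blast
    \<comment> \<open>The added term preserves every equation: \<open>M\<close> annihilates it from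
      the left, and \<open>?C\<close> satisfies \<open>?C ** M ** G = ?C\<close> and
      \<open>?C ** M ** D = 0\<close>.\<close>
    have "M ** (mat 1 - G ** M) = 0"
      using G(1) by (simp add: matrix_diff_ldistrib matrix_mul_assoc)
    then have MX': "M ** X = M ** G"
      using MX[OF X0] by (simp add: X matrix_add_ldistrib matrix_mul_assoc)
    have "?C ** M ** G = ?C"
      using G(2) unfolding matrix_diff_rdistrib by (metis matrix_mul_assoc)
    then have "X ** M ** G = X"
      using XMG[OF X0] unfolding X matrix_add_rdistrib by (metis matrix_mul_assoc)
    then have "X ** M ** X = X"
      using MX' by (metis matrix_mul_assoc)
    moreover have "?C ** M ** D = 0"
      using D G(1) unfolding matrix_diff_rdistrib by (metis diff_self matrix_mul_assoc)
    then have "X ** M ** D = D"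
      using X0 unfolding X matrix_add_rdistrib inverses_123_fixing_def
      by (simp flip: matrix_mul_assoc)
    ultimately show "X \<in> inverses_123_fixing M D"
      using G MX' by (simp add: inverses_123_fixing_def)
  qed
qed

lemma inverses_124_fixing_nonempty:
  assumes D: "D ** M ** D = D"
  shows "inverses_124_fixing M D \<noteq> {}"
proof -
  have "conj_transpose D ** conj_transpose M ** conj_transpose D = conj_transpose D"
    using D by (metis conj_transpose_mult matrix_mul_assoc)
  from inverses_123_fixing_nonempty[OF this] show ?thesis
    by (metis conj_transpose_conj_transpose ex_in_conv mem_inverses_124_fixing_iff)
qed

text \<open>This is the adjoint of \<open>inverses_123_fixing_eq\<close>. Its parameter
  \<open>U\<close> is the adjoint of \<open>V\<close>, and every matrix arises as such an
  adjoint.\<close>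

lemma inverses_124_fixing_eq:
  assumes D: "D ** M ** D = D" and Y0: "Y0 \<in> inverses_124_fixing M D"
    and mp: "is_moore_penrose M G"
  shows "inverses_124_fixing M D =
    {Y0 + (G - G ** M ** D ** M ** G) ** V ** (mat 1 - M ** G) | V. True}"
proof -
  let ?s = conj_transpose
  have D': "?s D ** ?s M ** ?s D = ?s D"
    using D by (metis conj_transpose_mult matrix_mul_assoc)
  have "Y \<in> inverses_124_fixing M D \<longleftrightarrow>
      (\<exists>V. Y = Y0 + (G - G ** M ** D ** M ** G) ** V ** (mat 1 - M ** G))" for Y
  proof -
    have eq: "?s (Y0 + (G - G ** M ** D ** M ** G) ** V ** (mat 1 - M ** G)) =
        ?s Y0 + (mat 1 - ?s G ** ?s M) ** ?s V ** (?s G - ?s G ** ?s M ** ?s D ** ?s M ** ?s G)" for V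
      by (simp add: conj_transpose_mult conj_transpose_add conj_transpose_diff conj_transpose_mat_1
          matrix_mul_assoc)
    have "Y \<in> inverses_124_fixing M D \<longleftrightarrow> (\<exists>U. ?s Y =
        ?s Y0 + (mat 1 - ?s G ** ?s M) ** U ** (?s G - ?s G ** ?s M ** ?s D ** ?s M ** ?s G))"
      using inverses_123_fixing_eq[OF D' _ is_moore_penrose_conj_transpose[OF mp], of "?s Y0"] Y0
      by (auto simp: mem_inverses_124_fixing_iff)
    also have "\<dots> \<longleftrightarrow> (\<exists>V. ?s Y = ?s (Y0 + (G - G ** M ** D ** M ** G) ** V ** (mat 1 - M ** G)))"
      unfolding eq by (metis conj_transpose_conj_transpose)
    finally show ?thesis unfolding conj_transpose_eq_iff .
  qed
  then show ?thesis by blast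
qed

section \<open>The rank condition\<close>

text \<open>Inserting the equation into itself exhibits \<open>A\<close> as a product with
  \<open>W ** A ** W\<close> as a factor, so the two ranks bound each other.\<close>

lemma eq1_imp_rank_eq:
  assumes "eq1 A W X"
  shows "rank (W ** A ** W) = rank A"
proof (rule antisym)
  show "rank (W ** A ** W) \<le> rank A"
    by (meson order_trans rank_mult_le_left rank_mult_le_right)
  have "A = A ** W ** X ** (W ** A ** W) ** (X ** W ** A)"
    using assms unfolding eq1_def by (metis matrix_mul_assoc)
  then have "rank A \<le> rank (A ** W ** X ** (W ** A ** W))"
    by (metis rank_mult_le_left)
  also have "\<dots> \<le> rank (W ** A ** W)" by (rule rank_mult_le_right)
  finally show "rank A \<le> rank (W ** A ** W)" .
qed

lemma eq1_iff_inner_inverse: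
  fixes A :: "complex^'n^'m" and W :: "complex^'m^'n"
  assumes r: "rank (W ** A ** W) = rank A"
  shows "eq1 A W X \<longleftrightarrow> W ** A ** W ** X ** (W ** A ** W) = W ** A ** W"
proof -
  \<comment> \<open>Both ranks lie between \<open>rank (W ** A ** W)\<close> and
    \<open>rank A\<close>, which coincide.\<close>
  have "rank (W ** A) = rank A" "rank (A ** W) = rank A"
    using r rank_mult_le_left[of "W ** A" W] rank_mult_le_right[of W A]
      rank_mult_le_right[of W "A ** W"] rank_mult_le_left[of A W]
    by (simp_all add: matrix_mul_assoc)
  then obtain P Q where P: "A = P ** W ** A" and Q: "A = A ** W ** Q"
    by (metis rank_mult_eq_right_imp_factor rank_mult_eq_left_imp_factor)
  show ?thesis
  proof
    assume "eq1 A W X"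
    then show "W ** A ** W ** X ** (W ** A ** W) = W ** A ** W"
      unfolding eq1_def by (metis matrix_mul_assoc)
  next
    let ?M = "W ** A ** W"
    assume *: "?M ** X ** ?M = ?M"
    \<comment> \<open>Multiplying \<open>*\<close> by \<open>P\<close> on the left and
      \<open>Q\<close> on the right recovers \<open>(1')\<close>, since
      \<open>P ** ?M ** Q = A\<close>.\<close>
    have "A ** W ** X ** W ** A = (P ** W ** A) ** W ** X ** W ** (A ** W ** Q)"
      using P Q by simp
    also have "\<dots> = P ** (?M ** X ** ?M) ** Q"
      by (simp add: matrix_mul_assoc)
    also have "\<dots> = (P ** W ** A) ** W ** Q"
      unfolding * by (simp add: matrix_mul_assoc)
    also have "\<dots> = A" using P Q by simp
    finally show "eq1 A W X" by (simp add: eq1_def)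
  qed
qed

lemma inverses_123_1k_eq_fixing:
  assumes "rank (W ** A ** W) = rank A" "k = weighted_index A W"
  shows "inverses_123_1k k A W = inverses_123_fixing (W ** A ** W) (weighted_drazin A W)"
  using eq1k_iff_mult_weighted_drazin[OF is_weighted_drazin_weighted_drazin assms(2)]
  by (simp add: inverses_123_1k_def inverses_123_fixing_def eq1_iff_inner_inverse[OF assms(1)]
      eq2_def eq3_def matrix_mul_assoc)

lemma inverses_124_k1_eq_fixing:
  assumes "rank (W ** A ** W) = rank A" "k = weighted_index A W"
  shows "inverses_124_k1 k A W = inverses_124_fixing (W ** A ** W) (weighted_drazin A W)"
  using eqk1_iff_mult_weighted_drazin[OF is_weighted_drazin_weighted_drazin assms(2)]
  by (simp add: inverses_124_k1_def inverses_124_fixing_def eq1_iff_inner_inverse[OF assms(1)]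
      eq2_def eq4_def matrix_mul_assoc)

theorem theorem3p2:
  fixes A :: "complex^'n^'m" and W :: "complex^'m^'n" and k :: nat
  assumes "k = weighted_index A W"
  shows "(rank (W ** A ** W) \<noteq> rank A \<longrightarrow>
            inverses_123_1k k A W = {} \<and> inverses_124_k1 k A W = {})
       \<and> (rank (W ** A ** W) = rank A \<longrightarrow>
            inverses_123_1k k A W \<noteq> {} \<and> inverses_124_k1 k A W \<noteq> {}
          \<and> (\<forall>X0 \<in> inverses_123_1k k A W.
               inverses_123_1k k A W =
                 {X0 + (mat 1 - moore_penrose (W ** A ** W) ** (W ** A ** W)) ** U **
                    (moore_penrose (W ** A ** W)
                     - moore_penrose (W ** A ** W) ** (W ** A ** W) ** weighted_drazin A W
                       ** (W ** A ** W) ** moore_penrose (W ** A ** W))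
                  | U :: complex^'m^'m. True})
          \<and> (\<forall>Y0 \<in> inverses_124_k1 k A W.
               inverses_124_k1 k A W =
                 {Y0 + (moore_penrose (W ** A ** W)
                     - moore_penrose (W ** A ** W) ** (W ** A ** W) ** weighted_drazin A W
                       ** (W ** A ** W) ** moore_penrose (W ** A ** W)) ** V **
                    (mat 1 - (W ** A ** W) ** moore_penrose (W ** A ** W))
                  | V :: complex^'n^'n. True}))"
proof (intro conjI impI ballI)
  let ?M = "W ** A ** W" and ?D = "weighted_drazin A W"
  have D: "?D ** ?M ** ?D = ?D"
    using is_weighted_drazin_weighted_drazin[of A W]
    unfolding is_weighted_drazin_def by (metis matrix_mul_assoc)
  note mp = is_moore_penrose_moore_penrose[of ?M]
  {
    assume "rank ?M \<noteq> rank A"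
    then have "\<not> eq1 A W X" for X using eq1_imp_rank_eq by blast
    then show "inverses_123_1k k A W = {}" "inverses_124_k1 k A W = {}"
      by (simp_all add: inverses_123_1k_def inverses_124_k1_def)
  }
  assume r: "rank ?M = rank A"
  note eqs = inverses_123_1k_eq_fixing[OF r assms] inverses_124_k1_eq_fixing[OF r assms]
  show "inverses_123_1k k A W \<noteq> {}" "inverses_124_k1 k A W \<noteq> {}"
    unfolding eqs using D by (rule inverses_123_fixing_nonempty inverses_124_fixing_nonempty)+
  show "inverses_123_1k k A W =
      {X0 + (mat 1 - moore_penrose ?M ** ?M) ** U **
        (moore_penrose ?M - moore_penrose ?M ** ?M ** ?D ** ?M ** moore_penrose ?M)
      | U :: complex^'m^'m. True}" if "X0 \<in> inverses_123_1k k A W" for X0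
    using inverses_123_fixing_eq[OF D _ mp] that unfolding eqs .
  show "inverses_124_k1 k A W =
      {Y0 + (moore_penrose ?M - moore_penrose ?M ** ?M ** ?D ** ?M ** moore_penrose ?M) ** V **
        (mat 1 - ?M ** moore_penrose ?M)
      | V :: complex^'n^'n. True}" if "Y0 \<in> inverses_124_k1 k A W" for Y0
    using inverses_124_fixing_eq[OF D _ mp] that unfolding eqs .
qed

end
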